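(* For every $\varepsilon>0$, the competitive ratio of the greedy algorithm for online decomposable weighted bipartite matching with free disposal (defined in the context) is at most $\frac{1}{2-\varepsilon}$. That is, there is an instance (together with a valid choice among tied machines whenever the greedy rule has ties) on which the value obtained by the greedy algorithm is at most $\frac{1}{2-\varepsilon}$ times the optimal offline value.
   Context: Problem (online decomposable weighted bipartite matching with free disposal). A finite set $V_1$ of machines with speeds $s:V_1\to\mathbb{R}_{>0}$ is known in advance. Jobs $v$ with sizes $w(v)>0$ arrive one at a time; when $v$ arrives, $w(v)$ is revealed and the algorithm must immediately and irrevocably assign $v$ to a machine (every job may be assigned to every machine, i.e. the bipartite graph is complete, and a machine may receive several jobs). The edge weight between machine $u$ and job $v$ is $s(u)\,w(v)$. At the end, each machine $u$ earns $s(u)$ times the maximum size of a job assigned to it (0 if none), and the algorithm's value is the sum of these earnings. $\mathrm{OPT}$ is the maximum value over all offline assignments. The competitive ratio of an algorithm is the infimum over instances of (its value)/$\mathrm{OPT}$. Greedy algorithm: when a job $v$ arrives, for every machine $u$ compute $s(u)w(v)-s(u)w(v')$, where $v'$ is the largest job currently assigned to $u$ (the subtracted term is $0$ if $u$ has no job); if this difference is positive for at least one machine, assign $v$ to a machine with maximum difference (ties among such machines broken arbitrarily).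
   Formalization: The statement is proved for 0 < ε < 2; for ε = 2 the bound 1/(2−ε) is undefined, and for ε > 2 it is negative, so the claim fails because the ratio is nonnegative. *)

theory Defs
  imports Complex_Main "HOL-Library.FuncSet"
begin

text \<open>Machines are named by natural numbers; jobs are the positions of the list \<open>sizes\<close>, in
  order of arrival.\<close>

record wbm_instance =
  machines :: "nat set"
  speed :: "nat \<Rightarrow> real"
  sizes :: "real list"

text \<open>At least one machine and one job are required: otherwise the optimum is 0 and the ratio
  of the algorithm's value to the optimum is meaningless (\<open>0 / 0 = 0\<close> in HOL).\<close>

definition valid_instance :: "wbm_instance \<Rightarrow> bool" where
  "valid_instance I \<longleftrightarrow>
     finite (machines I) \<and> machines I \<noteq> {} \<and> (\<forall>u\<in>machines I. speed I u > 0) \<and>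
     sizes I \<noteq> [] \<and> (\<forall>x\<in>set (sizes I). x > 0)"

definition assignments :: "wbm_instance \<Rightarrow> (nat \<Rightarrow> nat) set" where
  "assignments I = {..<length (sizes I)} \<rightarrow>\<^sub>E machines I"

text \<open>Size of the largest job that machine \<open>u\<close> has received among the first \<open>k\<close> arrivals.\<close>

definition largest_job :: "wbm_instance \<Rightarrow> (nat \<Rightarrow> nat) \<Rightarrow> nat \<Rightarrow> nat \<Rightarrow> real" where
  "largest_job I a k u =
     (let J = {j. j < k \<and> a j = u} in if J = {} then 0 else Max ((\<lambda>j. sizes I ! j) ` J))"

definition alg_value :: "wbm_instance \<Rightarrow> (nat \<Rightarrow> nat) \<Rightarrow> real" where
  "alg_value I a = (\<Sum>u\<in>machines I. speed I u * largest_job I a (length (sizes I)) u)"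

definition OPT :: "wbm_instance \<Rightarrow> real" where
  "OPT I = Max (alg_value I ` assignments I)"

definition gain :: "wbm_instance \<Rightarrow> (nat \<Rightarrow> nat) \<Rightarrow> nat \<Rightarrow> nat \<Rightarrow> real" where
  "gain I a k u = speed I u * sizes I ! k - speed I u * largest_job I a k u"

text \<open>All possible outcomes of the greedy algorithm, over all ways of breaking ties. A job with
  no positive gain may be placed on any machine: it is not larger than the largest job already
  there, so neither the value nor any later gain depends on where it goes.\<close>

definition greedy :: "wbm_instance \<Rightarrow> (nat \<Rightarrow> nat) set" where
  "greedy I = {a \<in> assignments I. \<forall>k<length (sizes I).
     (\<exists>u\<in>machines I. gain I a k u > 0) \<longrightarrow> (\<forall>u\<in>machines I. gain I a k u \<le> gain I a k (a k))}"

text \<open>An algorithm is given by its set of possible outcomes on each instance. The ratios are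
  nonnegative, so the infimum in the reals is the genuine one as soon as there is an outcome.\<close>

definition competitive_ratio :: "(wbm_instance \<Rightarrow> (nat \<Rightarrow> nat) set) \<Rightarrow> real" where
  "competitive_ratio alg = Inf {alg_value I a / OPT I | I a. valid_instance I \<and> a \<in> alg I}"

end

(* With a fast machine of speed 1, slow machines of speed 1 - q, and jobs of sizes
   q^N, ..., q^2, q, 1 in order of arrival, moving the fast machine from q^(i+1) to q^i gains
   (1 - q) q^i, exactly what an empty slow machine would gain from the new job. So greedy may put
   every job on the fast machine and end with value 1, whereas using one machine per job yields
   1 + (1 - q) (q + ... + q^N) = 1 + q (1 - q^N), which tends to 2 when first N tends to infinity
   and then q tends to 1. *)

theory Submission imports Defs begin

text \<open>A nonempty maximum is attained by a job, and job sizes are positive. The bound on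
  \<open>k\<close> keeps every index inside \<open>sizes I\<close>, where positivity is
  known.\<close>

lemma largest_job_nonneg:
  assumes "valid_instance I" "k \<le> length (sizes I)"
  shows "0 \<le> largest_job I a k u"
proof (cases "{j. j < k \<and> a j = u} = {}")
  case True
  then show ?thesis by (simp add: largest_job_def)
next
  case False
  let ?M = "(\<lambda>j. sizes I ! j) ` {j. j < k \<and> a j = u}"
  have "Max ?M \<in> ?M" using False by (intro Max_in) auto
  moreover have "\<forall>x\<in>?M. 0 < x"
    using assms by (auto simp: valid_instance_def)
  ultimately have "0 < Max ?M" by blast
  with False show ?thesis by (simp add: largest_job_def Let_def)
qed

lemma alg_value_nonneg: "valid_instance I \<Longrightarrow> 0 \<le> alg_value I a"
  unfolding alg_value_def
  by (intro sum_nonneg mult_nonneg_nonneg largest_job_nonneg)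
     (auto simp: valid_instance_def less_imp_le)

lemma alg_value_le_OPT:
  assumes "valid_instance I" "a \<in> assignments I"
  shows "alg_value I a \<le> OPT I"
proof -
  have "finite (assignments I)"
    using assms(1) by (auto simp: assignments_def valid_instance_def intro!: finite_PiE)
  with assms(2) show ?thesis unfolding OPT_def by (intro Max_ge) auto
qed

lemma OPT_nonneg: "\<lbrakk>valid_instance I; a \<in> assignments I\<rbrakk> \<Longrightarrow> 0 \<le> OPT I"
  using alg_value_nonneg alg_value_le_OPT by (meson order_trans)

text \<open>In the reals \<open>Inf\<close> is a lower bound only of a set that is bounded below.
  Here 0 is such a bound, since values and optima are nonnegative.\<close>

lemma competitive_ratio_greedy_le:
  assumes "valid_instance I" "a \<in> greedy I"
  shows "competitive_ratio greedy \<le> alg_value I a / OPT I"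
  unfolding competitive_ratio_def
proof (rule cInf_lower)
  show "bdd_below {alg_value I a / OPT I |I a. valid_instance I \<and> a \<in> greedy I}"
    by (rule bdd_belowI[of _ 0])
       (auto simp: greedy_def intro!: divide_nonneg_nonneg alg_value_nonneg OPT_nonneg)
qed (use assms in blast)

definition geometric_instance :: "real \<Rightarrow> nat \<Rightarrow> wbm_instance" where
  "geometric_instance q N =
    \<lparr>machines = {..N}, speed = (\<lambda>u. if u = 0 then 1 else 1 - q),
     sizes = map (\<lambda>k. q ^ (N - k)) [0..<Suc N]\<rparr>"

definition all_fast :: "nat \<Rightarrow> nat \<Rightarrow> nat" where
  "all_fast N = (\<lambda>k\<in>{..<Suc N}. 0)"

text \<open>Reversing the order sends the job of size \<open>q ^ u\<close> to machine
  \<open>u\<close>; the last and largest job thus lands on the fast machine 0.\<close>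

definition one_each :: "nat \<Rightarrow> nat \<Rightarrow> nat" where
  "one_each N = (\<lambda>k\<in>{..<Suc N}. N - k)"

lemma geometric_instance_sel [simp]:
  "machines (geometric_instance q N) = {..N}"
  "speed (geometric_instance q N) u = (if u = 0 then 1 else 1 - q)"
  "length (sizes (geometric_instance q N)) = Suc N"
  by (simp_all add: geometric_instance_def)

lemma sizes_geometric_instance [simp]:
  "k \<le> N \<Longrightarrow> sizes (geometric_instance q N) ! k = q ^ (N - k)"
  unfolding geometric_instance_def by (simp add: less_Suc_eq_le del: upt_Suc)

lemma valid_geometric_instance:
  assumes "0 < q" "q < 1"
  shows "valid_instance (geometric_instance q N)"
proof -
  have "sizes (geometric_instance q N) \<noteq> []"
    by (metis geometric_instance_sel(3) list.size(3) nat.distinct(1))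
  with assms show ?thesis
    by (auto simp: valid_instance_def geometric_instance_def)
qed

lemma all_fast_in_assignments: "all_fast N \<in> assignments (geometric_instance q N)"
  by (auto simp: assignments_def all_fast_def)

lemma one_each_in_assignments: "one_each N \<in> assignments (geometric_instance q N)"
  by (auto simp: assignments_def one_each_def)

text \<open>Sizes increase with arrival, so the maximum is the latest job \<open>k - 1\<close>, of
  size \<open>q ^ (N - (k - 1))\<close>. At \<open>k = 0\<close> the default 0 applies.\<close>

lemma largest_job_all_fast:
  assumes "0 < q" "q < 1" "k \<le> Suc N"
  shows "largest_job (geometric_instance q N) (all_fast N) k u =
    (if u = 0 \<and> 0 < k then q ^ (Suc N - k) else 0)"
proof -
  have J: "{j. j < k \<and> all_fast N j = u} = (if u = 0 then {..<k} else {})"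
    using assms(3) by (auto simp: all_fast_def)
  have "Max ((\<lambda>j. sizes (geometric_instance q N) ! j) ` {..<k}) = q ^ (Suc N - k)"
    if "0 < k"
  proof (rule Max_eqI)
    show "y \<le> q ^ (Suc N - k)"
      if "y \<in> (\<lambda>j. sizes (geometric_instance q N) ! j) ` {..<k}" for y
      using that assms by (auto intro!: power_decreasing)
    have "q ^ (Suc N - k) = sizes (geometric_instance q N) ! (k - 1)"
      using that assms(3) by simp
    then show "q ^ (Suc N - k) \<in> (\<lambda>j. sizes (geometric_instance q N) ! j) ` {..<k}"
      using that by auto
  qed simp
  then show ?thesis
    unfolding largest_job_def J by (auto simp: Let_def lessThan_empty_iff)
qed

lemma all_fast_in_greedy:
  assumes "0 < q" "q < 1"
  shows "all_fast N \<in> greedy (geometric_instance q N)"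
proof -
  let ?I = "geometric_instance q N"
  have "gain ?I (all_fast N) k u \<le> gain ?I (all_fast N) k (all_fast N k)"
    if k: "k \<le> N" for k u
  proof -
    have "all_fast N k = 0" using k by (simp add: all_fast_def)
    \<comment> \<open>This settles \<open>k = 0\<close>: the fast machine is still empty and gains
      the full \<open>q ^ N\<close>.\<close>
    moreover have "(1 - q) * q ^ (N - k) \<le> q ^ (N - k)"
      using assms by (simp add: mult_left_le_one_le)
    \<comment> \<open>For \<open>k > 0\<close> the fast machine holds the previous job, smaller by
      the factor \<open>q\<close>, so its gain is \<open>(1 - q) * q ^ (N - k)\<close>: a tie with
      every slow machine.\<close>
    moreover have "q ^ (Suc N - k) = q * q ^ (N - k)"
      using k by (simp add: Suc_diff_le)
    ultimately show ?thesis
      using assms k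
      by (auto simp: gain_def largest_job_all_fast algebra_simps)
  qed
  with all_fast_in_assignments show ?thesis by (auto simp: greedy_def)
qed

lemma alg_value_all_fast:
  assumes "0 < q" "q < 1"
  shows "alg_value (geometric_instance q N) (all_fast N) = 1"
proof -
  have "alg_value (geometric_instance q N) (all_fast N) = (\<Sum>u\<le>N. if u = 0 then 1 else 0)"
    unfolding alg_value_def by (rule sum.cong) (auto simp: largest_job_all_fast assms)
  then show ?thesis by simp
qed

lemma alg_value_one_each:
  "alg_value (geometric_instance q N) (one_each N) = 1 + q * (1 - q ^ N)"
proof -
  have J: "{j. j < Suc N \<and> one_each N j = u} = {N - u}" if "u \<le> N" for u
    using that by (auto simp: one_each_def)
  have "alg_value (geometric_instance q N) (one_each N) =
      (\<Sum>u\<le>N. (if u = 0 then 1 else 1 - q) * q ^ u)"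
    unfolding alg_value_def by (rule sum.cong) (auto simp: largest_job_def J)
  \<comment> \<open>The terms with \<open>u > 0\<close> are \<open>q ^ u - q ^ Suc u\<close>, so
    their sum telescopes to \<open>q - q ^ Suc N\<close>.\<close>
  also have "\<dots> = 1 + q * (1 - q ^ N)"
    by (induction N) (auto simp: algebra_simps)
  finally show ?thesis .
qed

theorem theorem1:
  fixes \<epsilon> :: real
  assumes "0 < \<epsilon>" and "\<epsilon> < 2"
  shows "competitive_ratio greedy \<le> 1 / (2 - \<epsilon>) \<and>
    (\<exists>I a. valid_instance I \<and> a \<in> greedy I \<and> alg_value I a \<le> 1 / (2 - \<epsilon>) * OPT I)"
proof -
  \<comment> \<open>This choice gives \<open>1 + q * q\<close> =
    \<open>2 - \<epsilon> + \<epsilon>\<^sup>2 / 4\<close>, which leaves room above the target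
    \<open>2 - \<epsilon>\<close>.\<close>
  define q where "q = 1 - \<epsilon> / 2"
  have q: "0 < q" "q < 1" using assms by (auto simp: q_def)
  \<comment> \<open>Since \<open>\<epsilon> / 2 = 1 - q\<close>, this makes \<open>1 - q ^ N\<close>
    exceed \<open>q\<close>.\<close>
  obtain N where N: "q ^ N < \<epsilon> / 2"
    using real_arch_pow_inv[of "\<epsilon> / 2" q] assms q by auto
  let ?I = "geometric_instance q N"
  have valid: "valid_instance ?I" using q by (rule valid_geometric_instance)
  have "2 - \<epsilon> \<le> 1 + q * q"
    by (simp add: q_def field_simps)
  also have "\<dots> \<le> 1 + q * (1 - q ^ N)"
    using q N by (intro add_left_mono mult_left_mono) (auto simp: q_def)
  also have "\<dots> \<le> OPT ?I"
    using alg_value_le_OPT[OF valid one_each_in_assignments] by (simp add: alg_value_one_each)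
  finally have OPT: "2 - \<epsilon> \<le> OPT ?I" .
  have greedy: "all_fast N \<in> greedy ?I" using q by (rule all_fast_in_greedy)
  have val: "alg_value ?I (all_fast N) = 1" using q by (rule alg_value_all_fast)
  have "competitive_ratio greedy \<le> 1 / OPT ?I"
    using competitive_ratio_greedy_le[OF valid greedy] val by simp
  also have "\<dots> \<le> 1 / (2 - \<epsilon>)"
    using OPT assms by (intro divide_left_mono) auto
  finally have "competitive_ratio greedy \<le> 1 / (2 - \<epsilon>)" .
  moreover have "alg_value ?I (all_fast N) \<le> 1 / (2 - \<epsilon>) * OPT ?I"
    using OPT assms val by simp
  ultimately show ?thesis using valid greedy by blast
qed

end
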